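(* Let $G$ be a $\overline{C}$-group. The map $\pi\colon A(G)\to G$ restricts to an isomorphism of the derived subgroups: $$A(G)'\ \cong\ G'.$$
   Context: For a group $G$, $A(G)=\langle e_a,\ a\in G\mid e_ae_b=e_be_{b^{-1}ab},\ a,b\in G\rangle$, and $\pi\colon A(G)\to G$ is the homomorphism $e_a\mapsto a$. A $\overline{C}$-group is a group $G$ admitting a presentation, with some generator set $\Gamma$, in which every relation is either a conjugation relation $b^{-1}ab=c$ with $a,b,c\in\Gamma$, or a power relation $a^k=1$ with $a\in\Gamma$, $k\ge 2$; there is at most one power relation per conjugacy class of $G$ (i.e., for each conjugacy class $\mathcal{O}$ of $G$, at most one power relation $a^k=1$ has $a\in\mathcal{O}$). *)

theory Defs
  imports "HOL-Algebra.Generated_Groups"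
begin

text \<open>Words over a set of generators and their formal inverses: the letter \<open>(a, True)\<close>
  stands for \<open>a\<close>, the letter \<open>(a, False)\<close> for its inverse. A relation \<open>u = v\<close> of a
  presentation is the pair of words \<open>(u, v)\<close>.\<close>

type_synonym 'a gword = "('a \<times> bool) list"

definition gwords :: "'a set \<Rightarrow> 'a gword set" where
  "gwords X = lists (X \<times> UNIV)"

inductive_set pres_rel :: "'a set \<Rightarrow> ('a gword \<times> 'a gword) set \<Rightarrow> ('a gword \<times> 'a gword) set"
  for X :: "'a set" and R :: "('a gword \<times> 'a gword) set" where
  refl: "w \<in> gwords X \<Longrightarrow> (w, w) \<in> pres_rel X R"
| sym: "(u, v) \<in> pres_rel X R \<Longrightarrow> (v, u) \<in> pres_rel X R"
| trans: "(u, v) \<in> pres_rel X R \<Longrightarrow> (v, w) \<in> pres_rel X R \<Longrightarrow> (u, w) \<in> pres_rel X R"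
| cancel: "u \<in> gwords X \<Longrightarrow> v \<in> gwords X \<Longrightarrow> a \<in> X \<Longrightarrow>
    (u @ [(a, s), (a, \<not> s)] @ v, u @ v) \<in> pres_rel X R"
| relator: "u \<in> gwords X \<Longrightarrow> v \<in> gwords X \<Longrightarrow> l \<in> gwords X \<Longrightarrow> r \<in> gwords X \<Longrightarrow> (l, r) \<in> R \<Longrightarrow>
    (u @ l @ v, u @ r @ v) \<in> pres_rel X R"

definition presented_group ::
    "'a set \<Rightarrow> ('a gword \<times> 'a gword) set \<Rightarrow> 'a gword set monoid" where
  "presented_group X R =
    \<lparr>carrier = gwords X // pres_rel X R,
     mult = (\<lambda>A B. \<Union>u\<in>A. \<Union>v\<in>B. pres_rel X R `` {u @ v}),
     one = pres_rel X R `` {[]}\<rparr>"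

definition pres_gen :: "'a set \<Rightarrow> ('a gword \<times> 'a gword) set \<Rightarrow> 'a \<Rightarrow> 'a gword set" where
  "pres_gen X R a = pres_rel X R `` {[(a, True)]}"

definition is_presentation ::
    "('a, 'm) monoid_scheme \<Rightarrow> 'a set \<Rightarrow> ('a gword \<times> 'a gword) set \<Rightarrow> bool" where
  "is_presentation G X R \<longleftrightarrow>
    X \<subseteq> carrier G \<and> R \<subseteq> gwords X \<times> gwords X \<and>
    (\<exists>h \<in> iso (presented_group X R) G. \<forall>a\<in>X. h (pres_gen X R a) = a)"

text \<open>The value in \<open>G\<close> of a word in elements of \<open>G\<close>.\<close>

primrec word_val :: "('a, 'm) monoid_scheme \<Rightarrow> 'a gword \<Rightarrow> 'a" where
  "word_val G [] = \<one>\<^bsub>G\<^esub>"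
| "word_val G (x # w) = (if snd x then fst x else inv\<^bsub>G\<^esub> (fst x)) \<otimes>\<^bsub>G\<^esub> word_val G w"

definition A_rels :: "('a, 'm) monoid_scheme \<Rightarrow> ('a gword \<times> 'a gword) set" where
  "A_rels G = {([(a, True), (b, True)], [(b, True), (inv\<^bsub>G\<^esub> b \<otimes>\<^bsub>G\<^esub> a \<otimes>\<^bsub>G\<^esub> b, True)]) | a b.
     a \<in> carrier G \<and> b \<in> carrier G}"

definition A_group :: "('a, 'm) monoid_scheme \<Rightarrow> 'a gword set monoid" where
  "A_group G = presented_group (carrier G) (A_rels G)"

definition A_gen :: "('a, 'm) monoid_scheme \<Rightarrow> 'a \<Rightarrow> 'a gword set" where
  "A_gen G a = pres_gen (carrier G) (A_rels G) a"

text \<open>The common value in \<open>G\<close> of the words in a class; lemmas \<open>A_proj_hom\<close> and \<open>A_proj_gen\<close>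
  below show that this is the homomorphism sending each \<open>e\<^sub>a\<close> to \<open>a\<close>.\<close>

definition A_proj :: "('a, 'm) monoid_scheme \<Rightarrow> 'a gword set \<Rightarrow> 'a" where
  "A_proj G c = the_elem (word_val G ` c)"

definition conj_class :: "('a, 'm) monoid_scheme \<Rightarrow> 'a \<Rightarrow> 'a set" where
  "conj_class G x = {inv\<^bsub>G\<^esub> g \<otimes>\<^bsub>G\<^esub> x \<otimes>\<^bsub>G\<^esub> g | g. g \<in> carrier G}"

text \<open>A triple \<open>(a, b, c)\<close> encodes the relation \<open>b\<^sup>-\<^sup>1ab = c\<close>, a pair \<open>(a, k)\<close> the
  relation \<open>a\<^sup>k = 1\<close>.\<close>

definition conj_rels :: "('a \<times> 'a \<times> 'a) set \<Rightarrow> ('a gword \<times> 'a gword) set" where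
  "conj_rels C = {([(b, False), (a, True), (b, True)], [(c, True)]) | a b c. (a, b, c) \<in> C}"

definition power_rels :: "('a \<times> nat) set \<Rightarrow> ('a gword \<times> 'a gword) set" where
  "power_rels P = {(replicate k (a, True), []) | a k. (a, k) \<in> P}"

definition Cbar_group :: "('a, 'm) monoid_scheme \<Rightarrow> bool" where
  "Cbar_group G \<longleftrightarrow> group G \<and>
    (\<exists>\<Gamma> C P. C \<subseteq> \<Gamma> \<times> \<Gamma> \<times> \<Gamma> \<and> P \<subseteq> \<Gamma> \<times> {2..} \<and>
       is_presentation G \<Gamma> (conj_rels C \<union> power_rels P) \<and>
       (\<forall>x\<in>carrier G. \<forall>p\<in>P. \<forall>q\<in>P.
          fst p \<in> conj_class G x \<and> fst q \<in> conj_class G x \<longrightarrow> p = q))"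

lemma gwords_append [simp]: "u @ v \<in> gwords X \<longleftrightarrow> u \<in> gwords X \<and> v \<in> gwords X"
  by (auto simp: gwords_def)

lemma gwords_Nil [simp]: "[] \<in> gwords X"
  by (simp add: gwords_def)

lemma gwords_Cons [simp]: "x # w \<in> gwords X \<longleftrightarrow> fst x \<in> X \<and> w \<in> gwords X"
  by (cases x) (auto simp: gwords_def)

lemma pres_rel_gwords: "(u, v) \<in> pres_rel X R \<Longrightarrow> u \<in> gwords X \<and> v \<in> gwords X"
  by (induction rule: pres_rel.induct) auto

lemma equiv_pres_rel: "equiv (gwords X) (pres_rel X R)"
proof (rule equivI)
  show "pres_rel X R \<subseteq> gwords X \<times> gwords X" using pres_rel_gwords by auto
  show "refl_on (gwords X) (pres_rel X R)"
    by (auto simp: refl_on_def intro: pres_rel.refl)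
  show "sym (pres_rel X R)" by (auto simp: sym_def intro: pres_rel.sym)
  show "trans (pres_rel X R)" by (auto simp: trans_def intro: pres_rel.trans)
qed

lemma pres_rel_ctxt:
  assumes "(u, v) \<in> pres_rel X R" "p \<in> gwords X" "q \<in> gwords X"
  shows "(p @ u @ q, p @ v @ q) \<in> pres_rel X R"
  using assms
proof (induction rule: pres_rel.induct)
  case (refl w) then show ?case by (auto intro: pres_rel.refl)
next
  case (sym u v) then show ?case by (auto intro: pres_rel.sym)
next
  case (trans u v w) then show ?case by (blast intro: pres_rel.trans)
next
  case (cancel u v a s)
  then show ?case using pres_rel.cancel[of "p @ u" X "v @ q" a s R] by simp
next
  case (relator u v l r)
  then show ?case using pres_rel.relator[of "p @ u" X "v @ q" l r R] by simp
qed

lemma pres_rel_append: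
  assumes "(u, u') \<in> pres_rel X R" "(v, v') \<in> pres_rel X R"
  shows "(u @ v, u' @ v') \<in> pres_rel X R"
proof -
  have "(u @ v, u' @ v) \<in> pres_rel X R"
    using pres_rel_ctxt[OF assms(1), of "[]" v] pres_rel_gwords[OF assms(2)] by simp
  moreover have "(u' @ v, u' @ v') \<in> pres_rel X R"
    using pres_rel_ctxt[OF assms(2), of u' "[]"] pres_rel_gwords[OF assms(1)] by simp
  ultimately show ?thesis by (rule pres_rel.trans)
qed

lemma presented_group_mult_class:
  assumes "u \<in> gwords X" "v \<in> gwords X"
  shows "pres_rel X R `` {u} \<otimes>\<^bsub>presented_group X R\<^esub> pres_rel X R `` {v} = pres_rel X R `` {u @ v}"
proof -
  let ?c = "\<lambda>w. pres_rel X R `` {w}"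
  have eq: "?c (u' @ v') = ?c (u @ v)" if "u' \<in> ?c u" "v' \<in> ?c v" for u' v'
    using that pres_rel_append[of u u' X R v v'] equiv_class_eq[OF equiv_pres_rel, of "u @ v" "u' @ v'" X R]
    by simp
  have "u \<in> ?c u" "v \<in> ?c v"
    using assms by (auto intro: pres_rel.refl)
  then have ne: "?c u \<noteq> {}" "?c v \<noteq> {}" by blast+
  have "(\<Union>u'\<in>?c u. \<Union>v'\<in>?c v. ?c (u' @ v')) = (\<Union>u'\<in>?c u. \<Union>v'\<in>?c v. ?c (u @ v))"
    by (intro SUP_cong HOL.refl eq)
  also have "\<dots> = ?c (u @ v)" using ne by (simp only: UN_constant if_False)
  finally have "(\<Union>u'\<in>?c u. \<Union>v'\<in>?c v. ?c (u' @ v')) = ?c (u @ v)" .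
  then show ?thesis by (simp add: presented_group_def)
qed

lemma pres_rel_inverse:
  assumes "w \<in> gwords X"
  shows "(map (\<lambda>(a, s). (a, \<not> s)) (rev w) @ w, []) \<in> pres_rel X R"
  using assms
proof (induction w)
  case Nil then show ?case by (auto intro: pres_rel.refl)
next
  case (Cons x w)
  obtain a s where x: "x = (a, s)" by (cases x)
  let ?i = "map (\<lambda>(a, s). (a, \<not> s)) (rev w)"
  have i: "?i \<in> gwords X" using Cons.prems by (auto simp: gwords_def)
  have "(?i @ [(a, \<not> s), (a, \<not> \<not> s)] @ w, ?i @ w) \<in> pres_rel X R"
    using Cons.prems i x by (intro pres_rel.cancel) auto
  then have "(?i @ [(a, \<not> s), (a, s)] @ w, []) \<in> pres_rel X R"
    using Cons.IH Cons.prems by (auto intro: pres_rel.trans)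
  then show ?case by (simp add: x)
qed

lemma presented_group_group: "group (presented_group X R)"
proof (rule groupI)
  let ?P = "presented_group X R"
  let ?c = "\<lambda>w. pres_rel X R `` {w}"
  have car: "carrier ?P = ?c ` gwords X"
    by (auto simp: presented_group_def quotient_def)
  have one: "\<one>\<^bsub>?P\<^esub> = ?c []" by (simp add: presented_group_def)
  show "x \<otimes>\<^bsub>?P\<^esub> y \<in> carrier ?P" if "x \<in> carrier ?P" "y \<in> carrier ?P" for x y
    using that by (auto simp: car presented_group_mult_class)
  show "\<one>\<^bsub>?P\<^esub> \<in> carrier ?P" by (auto simp: car one)
  show "x \<otimes>\<^bsub>?P\<^esub> y \<otimes>\<^bsub>?P\<^esub> z = x \<otimes>\<^bsub>?P\<^esub> (y \<otimes>\<^bsub>?P\<^esub> z)"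
    if "x \<in> carrier ?P" "y \<in> carrier ?P" "z \<in> carrier ?P" for x y z
    using that by (auto simp: car presented_group_mult_class)
  show "\<one>\<^bsub>?P\<^esub> \<otimes>\<^bsub>?P\<^esub> x = x" if "x \<in> carrier ?P" for x
    using that by (auto simp: car one presented_group_mult_class)
  show "\<exists>y\<in>carrier ?P. y \<otimes>\<^bsub>?P\<^esub> x = \<one>\<^bsub>?P\<^esub>" if x: "x \<in> carrier ?P" for x
  proof -
    obtain w where w: "w \<in> gwords X" "x = ?c w" using x by (auto simp: car)
    let ?i = "map (\<lambda>(a, s). (a, \<not> s)) (rev w)"
    have i: "?i \<in> gwords X" using w by (auto simp: gwords_def)
    have "?c ?i \<otimes>\<^bsub>?P\<^esub> x = \<one>\<^bsub>?P\<^esub>"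
      using w i pres_rel_inverse[OF w(1)] equiv_class_eq[OF equiv_pres_rel]
      by (metis one presented_group_mult_class)
    then show ?thesis using i by (auto simp: car)
  qed
qed

lemma (in group) word_val_closed: "w \<in> gwords (carrier G) \<Longrightarrow> word_val G w \<in> carrier G"
  by (induction w) auto

lemma (in group) word_val_append:
  "u \<in> gwords (carrier G) \<Longrightarrow> v \<in> gwords (carrier G) \<Longrightarrow>
    word_val G (u @ v) = word_val G u \<otimes> word_val G v"
  by (induction u) (auto simp: word_val_closed m_assoc)

lemma (in group) word_val_cong:
  assumes "(u, v) \<in> pres_rel (carrier G) (A_rels G)"
  shows "word_val G u = word_val G v"
  using assms
proof (induction rule: pres_rel.induct)
  case (cancel u v a s)
  then have "word_val G [(a, s), (a, \<not> s)] = \<one>" by (cases s) simp_all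
  moreover have "[(a, s), (a, \<not> s)] \<in> gwords (carrier G)" using cancel by simp
  ultimately show ?case using cancel
    by (simp only: word_val_append gwords_append word_val_closed l_one simp_thms)
next
  case (relator u v l r)
  then have "word_val G l = word_val G r"
    by (auto simp: A_rels_def m_assoc[symmetric])
  with relator show ?case by (simp add: word_val_append)
qed auto

lemma (in group) A_proj_class:
  assumes "w \<in> gwords (carrier G)"
  shows "A_proj G (pres_rel (carrier G) (A_rels G) `` {w}) = word_val G w"
proof -
  let ?c = "pres_rel (carrier G) (A_rels G) `` {w}"
  have "w \<in> ?c" using pres_rel.refl[OF assms] by simp
  moreover have "word_val G v = word_val G w" if "v \<in> ?c" for v
    using that word_val_cong[of w v] by simp
  ultimately have "word_val G ` ?c = {word_val G w}"
    by (metis (no_types, lifting) image_cong image_constant)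
  then show ?thesis by (simp add: A_proj_def)
qed

lemma (in group) A_proj_hom: "A_proj G \<in> hom (A_group G) G"
proof (rule homI)
  have car: "carrier (A_group G) = (\<lambda>w. pres_rel (carrier G) (A_rels G) `` {w}) ` gwords (carrier G)"
    by (auto simp: A_group_def presented_group_def quotient_def)
  show "A_proj G x \<in> carrier G" if "x \<in> carrier (A_group G)" for x
    using that by (auto simp: car A_proj_class word_val_closed)
  show "A_proj G (x \<otimes>\<^bsub>A_group G\<^esub> y) = A_proj G x \<otimes> A_proj G y"
    if "x \<in> carrier (A_group G)" "y \<in> carrier (A_group G)" for x y
    using that unfolding car
    by (auto simp: A_group_def presented_group_mult_class A_proj_class word_val_append)
qed

lemma (in group) A_proj_gen: "a \<in> carrier G \<Longrightarrow> A_proj G (A_gen G a) = a"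
  by (simp add: A_gen_def pres_gen_def A_proj_class)

end

theory Submission
  imports Defs
begin

text \<open>Conjugation by \<open>x\<close> sends \<open>e\<^sub>a\<close> to the generator indexed by the conjugate of \<open>a\<close> by
  \<open>\<pi>(x)\<close>, so the kernel of \<open>\<pi>\<close> is central in \<open>A(G)\<close>. As \<open>\<Gamma>\<close> generates \<open>G\<close>, the group \<open>A(G)\<close> is
  the product of this kernel and the subgroup \<open>H\<close> generated by the \<open>e\<^sub>a\<close> with \<open>a \<in> \<Gamma>\<close>; hence
  \<open>A(G)' \<subseteq> H\<close>. The conjugation relations of \<open>G\<close> already hold between the \<open>e\<^sub>a\<close>, so an element
  of \<open>H\<close> in the kernel is a product of the central elements \<open>e\<^sub>a\<^sup>k\<close> and their inverses, one for
  each power relation \<open>a\<^sup>k = 1\<close>. The total exponent of the generators indexed by a fixed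
  conjugacy class is a homomorphism from \<open>A(G)\<close> to the integers, so it vanishes on \<open>A(G)'\<close>; since
  each class carries at most one power relation, these homomorphisms force all exponents in
  such a product to be zero.\<close>

section \<open>Words, presentations and generated subgroups\<close>

lemma carrier_presented_group:
  "carrier (presented_group X R) = (\<lambda>w. pres_rel X R `` {w}) ` gwords X"
  by (auto simp: presented_group_def quotient_def)

lemma one_presented_group: "\<one>\<^bsub>presented_group X R\<^esub> = pres_rel X R `` {[]}"
  by (simp add: presented_group_def)

lemma gwords_mono: "X \<subseteq> Y \<Longrightarrow> gwords X \<subseteq> gwords Y"
  by (auto simp: gwords_def)

lemma gwords_replicate: "fst x \<in> X \<Longrightarrow> replicate n x \<in> gwords X"
  by (induction n) auto

lemma pres_class_eq_iff:
  assumes "u \<in> gwords X" "v \<in> gwords X"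
  shows "pres_rel X R `` {u} = pres_rel X R `` {v} \<longleftrightarrow> (u, v) \<in> pres_rel X R"
  using eq_equiv_class_iff[OF equiv_pres_rel] assms by metis

lemma presented_group_inv_gen:
  assumes "a \<in> X"
  shows "inv\<^bsub>presented_group X R\<^esub> (pres_rel X R `` {[(a, s)]}) = pres_rel X R `` {[(a, \<not> s)]}"
proof -
  interpret P: group "presented_group X R" by (rule presented_group_group)
  have "pres_rel X R `` {[(a, \<not> s)] @ [(a, s)]} = \<one>\<^bsub>presented_group X R\<^esub>"
    unfolding one_presented_group
    using assms pres_rel.cancel[of "[]" X "[]" a "\<not> s" R]
    by (subst pres_class_eq_iff) auto
  then show ?thesis
    using assms presented_group_mult_class[of "[(a, \<not> s)]" X "[(a, s)]" R]
    by (intro P.inv_equality) (auto simp: carrier_presented_group)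
qed

lemma hom_presented_group_word_val:
  assumes "group G" "X \<subseteq> carrier G" and h: "h \<in> hom (presented_group X R) G"
    and gen: "\<And>a. a \<in> X \<Longrightarrow> h (pres_gen X R a) = a"
    and "w \<in> gwords X"
  shows "h (pres_rel X R `` {w}) = word_val G w"
proof -
  interpret G: group G by fact
  interpret P: group "presented_group X R" by (rule presented_group_group)
  interpret h: group_hom "presented_group X R" G h by unfold_locales (fact h)
  show ?thesis
    using \<open>w \<in> gwords X\<close>
  proof (induction w)
    case Nil
    then show ?case using h.hom_one by (simp add: one_presented_group)
  next
    case (Cons x w)
    obtain a s where x: "x = (a, s)" by (cases x)
    have a: "a \<in> X" and w: "w \<in> gwords X" using Cons.prems x by auto
    have car: "pres_rel X R `` {[(a, s)]} \<in> carrier (presented_group X R)" for s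
      using a by (auto simp: carrier_presented_group)
    have "h (pres_rel X R `` {[(a, s)]}) = (if s then a else inv\<^bsub>G\<^esub> a)"
    proof (cases s)
      case True
      then show ?thesis using gen[OF a] by (simp add: pres_gen_def)
    next
      case False
      then show ?thesis
        using gen[OF a] presented_group_inv_gen[OF a, of R True] h.hom_inv[OF car[of True]]
        by (simp add: pres_gen_def)
    qed
    moreover have "pres_rel X R `` {w} \<in> carrier (presented_group X R)"
      using w by (auto simp: carrier_presented_group)
    moreover have "pres_rel X R `` {x # w} =
        pres_rel X R `` {[(a, s)]} \<otimes>\<^bsub>presented_group X R\<^esub> pres_rel X R `` {w}"
      using presented_group_mult_class[of "[(a, s)]" X w R] a w x by simp
    ultimately show ?case using Cons.IH[OF w] car x by simp
  qed
qed

text \<open>The isomorphism in \<open>is_presentation\<close> maps the class of a word to the value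
  of the word, so its injectivity says that every equation between words in \<open>X\<close> that
  holds in \<open>G\<close> can be derived from \<open>R\<close>. This is how the completeness of a
  presentation is used.\<close>

lemma is_presentation_pres_rel_iff:
  assumes "group G" "is_presentation G X R" "u \<in> gwords X" "v \<in> gwords X"
  shows "(u, v) \<in> pres_rel X R \<longleftrightarrow> word_val G u = word_val G v"
proof -
  obtain h where h: "h \<in> iso (presented_group X R) G" "\<And>a. a \<in> X \<Longrightarrow> h (pres_gen X R a) = a"
    and X: "X \<subseteq> carrier G"
    using assms(2) by (auto simp: is_presentation_def)
  have hom: "h \<in> hom (presented_group X R) G"
    and inj: "inj_on h (carrier (presented_group X R))"
    using h(1) by (auto simp: iso_def bij_betw_def)
  have "word_val G u = word_val G v \<longleftrightarrow> h (pres_rel X R `` {u}) = h (pres_rel X R `` {v})"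
    using hom_presented_group_word_val[OF assms(1) X hom h(2)] assms(3,4) by simp
  also have "\<dots> \<longleftrightarrow> pres_rel X R `` {u} = pres_rel X R `` {v}"
    using inj assms(3,4) by (auto simp: carrier_presented_group dest: inj_onD)
  finally show ?thesis using assms(3,4) by (simp add: pres_class_eq_iff)
qed

text \<open>Surjectivity of the same isomorphism: the set \<open>X\<close> generates
  \<open>G\<close>.\<close>

lemma is_presentation_word_val_surj:
  assumes "group G" "is_presentation G X R" "g \<in> carrier G"
  obtains w where "w \<in> gwords X" "word_val G w = g"
proof -
  obtain h where h: "h \<in> iso (presented_group X R) G" "\<And>a. a \<in> X \<Longrightarrow> h (pres_gen X R a) = a"
    and X: "X \<subseteq> carrier G"
    using assms(2) by (auto simp: is_presentation_def)
  have hom: "h \<in> hom (presented_group X R) G"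
    and "g \<in> h ` carrier (presented_group X R)"
    using h(1) assms(3) by (auto simp: iso_def bij_betw_def)
  then obtain w where "w \<in> gwords X" "g = h (pres_rel X R `` {w})"
    by (auto simp: carrier_presented_group)
  then show ?thesis
    using that hom_presented_group_word_val[OF assms(1) X hom h(2)] by metis
qed

text \<open>The set of power relations may be infinite, while the argument that removes the powers
  one by one is an induction over a finite set. Each element involves only finitely many
  generators.\<close>

lemma generate_finite_support:
  assumes "z \<in> generate H (f ` P)"
  shows "\<exists>F \<subseteq> P. finite F \<and> z \<in> generate H (f ` F)"
  using assms
proof (induction rule: generate.induct)
  case one
  show ?case by (intro exI[of _ "{}"]) (auto intro: generate.one)
next
  case (incl h)
  then obtain p where "p \<in> P" "h = f p" by auto
  then show ?case by (intro exI[of _ "{p}"]) (auto intro: generate.incl)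
next
  case (inv h)
  then obtain p where "p \<in> P" "h = f p" by auto
  then show ?case by (intro exI[of _ "{p}"]) (auto intro: generate.inv)
next
  case (eng h1 h2)
  then obtain F1 F2 where F: "F1 \<subseteq> P" "finite F1" "h1 \<in> generate H (f ` F1)"
      "F2 \<subseteq> P" "finite F2" "h2 \<in> generate H (f ` F2)"
    by blast
  have "generate H (f ` F) \<subseteq> generate H (f ` (F1 \<union> F2))" if "F \<subseteq> F1 \<union> F2" for F
  proof
    fix x assume "x \<in> generate H (f ` F)"
    then show "x \<in> generate H (f ` (F1 \<union> F2))"
      using that by (induction rule: generate.induct) (auto intro: generate.intros)
  qed
  then have "h1 \<in> generate H (f ` (F1 \<union> F2))" "h2 \<in> generate H (f ` (F1 \<union> F2))"
    using F by blast+
  then show ?case using F by (intro exI[of _ "F1 \<union> F2"]) (auto intro: generate.eng)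
qed

section \<open>Exponent sums over a set of letters\<close>

definition class_degree :: "'a set \<Rightarrow> 'a gword \<Rightarrow> int" where
  "class_degree D w = (\<Sum>(a, s)\<leftarrow>w. if a \<in> D then if s then 1 else - 1 else 0)"

lemma class_degree_append [simp]:
  "class_degree D (u @ v) = class_degree D u + class_degree D v"
  by (simp add: class_degree_def)

lemma class_degree_Nil [simp]: "class_degree D [] = 0"
  by (simp add: class_degree_def)

text \<open>The choice of a representative is harmless when \<open>D\<close> is closed under
  conjugation: by \<open>class_degree_cong\<close> all words in a class of \<open>A_group G\<close>
  then have the same degree. Conjugacy classes satisfy this by
  \<open>conj_class_invariant\<close>.\<close>

definition A_degree :: "'a set \<Rightarrow> 'a gword set \<Rightarrow> int" where
  "A_degree D x = class_degree D (SOME w. w \<in> x)"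

section \<open>Conjugation in \<open>A_group G\<close> and centrality of the kernel\<close>

context group
begin

interpretation A: group "A_group G"
  unfolding A_group_def by (rule presented_group_group)

interpretation pi: group_hom "A_group G" G "A_proj G"
  by unfold_locales (rule A_proj_hom)

abbreviation A_class :: "'a gword \<Rightarrow> 'a gword set" where
  "A_class w \<equiv> pres_rel (carrier G) (A_rels G) `` {w}"

lemma carrier_A_group: "carrier (A_group G) = A_class ` gwords (carrier G)"
  by (simp add: A_group_def carrier_presented_group)

lemma A_class_closed: "w \<in> gwords (carrier G) \<Longrightarrow> A_class w \<in> carrier (A_group G)"
  by (simp add: carrier_A_group)

lemma one_A_group: "\<one>\<^bsub>A_group G\<^esub> = A_class []"
  by (simp add: A_group_def one_presented_group)

lemma A_class_append:
  "u \<in> gwords (carrier G) \<Longrightarrow> v \<in> gwords (carrier G) \<Longrightarrow>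
    A_class (u @ v) = A_class u \<otimes>\<^bsub>A_group G\<^esub> A_class v"
  by (simp add: A_group_def presented_group_mult_class)

lemma A_class_Cons:
  "fst x \<in> carrier G \<Longrightarrow> w \<in> gwords (carrier G) \<Longrightarrow>
    A_class (x # w) = A_class [x] \<otimes>\<^bsub>A_group G\<^esub> A_class w"
  using A_class_append[of "[x]" w] by simp

lemma A_class_letter:
  "a \<in> carrier G \<Longrightarrow> A_class [(a, s)] = (if s then A_gen G a else inv\<^bsub>A_group G\<^esub> A_gen G a)"
  using presented_group_inv_gen[of a "carrier G" "A_rels G" True]
  by (simp add: A_gen_def pres_gen_def A_group_def)

lemma A_gen_closed: "a \<in> carrier G \<Longrightarrow> A_gen G a \<in> carrier (A_group G)"
  by (simp add: A_gen_def pres_gen_def A_class_closed)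

lemma A_gen_mult:
  assumes "a \<in> carrier G" "b \<in> carrier G"
  shows "A_gen G a \<otimes>\<^bsub>A_group G\<^esub> A_gen G b = A_gen G b \<otimes>\<^bsub>A_group G\<^esub> A_gen G (inv b \<otimes> a \<otimes> b)"
proof -
  let ?l = "[(a, True), (b, True)]" and ?r = "[(b, True), (inv b \<otimes> a \<otimes> b, True)]"
  have "(?l, ?r) \<in> A_rels G" using assms by (auto simp: A_rels_def)
  then have "(?l, ?r) \<in> pres_rel (carrier G) (A_rels G)"
    using assms pres_rel.relator[of "[]" "carrier G" "[]" ?l ?r "A_rels G"] by simp
  then have "A_class ?l = A_class ?r"
    using assms by (subst pres_class_eq_iff) auto
  then show ?thesis using assms by (simp add: A_class_Cons[of _ "[_]"] A_class_letter)
qed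

text \<open>The generator is moved past the word one letter at a time. Each letter conjugates the
  index by its value in \<open>G\<close>, and these conjugations compose to conjugation by the value
  of the whole word.\<close>

lemma A_gen_mult_class:
  assumes "w \<in> gwords (carrier G)" "a \<in> carrier G"
  shows "A_gen G a \<otimes>\<^bsub>A_group G\<^esub> A_class w =
    A_class w \<otimes>\<^bsub>A_group G\<^esub> A_gen G (inv (word_val G w) \<otimes> a \<otimes> word_val G w)"
  using assms
proof (induction w arbitrary: a)
  case Nil
  then show ?case by (simp add: one_A_group[symmetric] A_gen_closed)
next
  case (Cons x w)
  obtain b s where x: "x = (b, s)" by (cases x)
  define g where "g = (if s then b else inv b)"
  have b: "b \<in> carrier G" and w: "w \<in> gwords (carrier G)" using Cons.prems x by auto
  have g: "g \<in> carrier G" using b by (simp add: g_def)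
  define a' where "a' = inv g \<otimes> a \<otimes> g"
  have a': "a' \<in> carrier G" using g Cons.prems by (simp add: a'_def)
  note cl = A_gen_closed A_class_closed word_val_closed[OF w]
  have step: "A_gen G a \<otimes>\<^bsub>A_group G\<^esub> A_class [x] = A_class [x] \<otimes>\<^bsub>A_group G\<^esub> A_gen G a'"
  proof (cases s)
    case True
    then show ?thesis using A_gen_mult[of a b] b Cons.prems
      by (simp add: x A_class_letter a'_def g_def)
  next
    case False
    \<comment> \<open>For an inverse letter, \<open>a'\<close> is \<open>a\<close> conjugated by
      \<open>inv b\<close>. Hence \<open>a\<close> is the conjugate of \<open>a'\<close> by
      \<open>b\<close>, and the defining relation for the pair \<open>a'\<close>, \<open>b\<close>
      can be read backwards.\<close>
    have "a = inv b \<otimes> a' \<otimes> b" using False b Cons.prems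
      by (simp add: a'_def g_def m_assoc inv_solve_left)
    then have eq: "A_gen G a' \<otimes>\<^bsub>A_group G\<^esub> A_gen G b = A_gen G b \<otimes>\<^bsub>A_group G\<^esub> A_gen G a"
      using A_gen_mult[of a' b] a' b by simp
    have "A_gen G a = inv\<^bsub>A_group G\<^esub> A_gen G b \<otimes>\<^bsub>A_group G\<^esub> (A_gen G a' \<otimes>\<^bsub>A_group G\<^esub> A_gen G b)"
      unfolding eq using b Cons.prems by (simp add: cl A.inv_solve_left)
    then show ?thesis using False b a' Cons.prems
      by (simp add: x A_class_letter cl A.m_assoc)
  qed
  have v: "word_val G (x # w) = g \<otimes> word_val G w" by (simp add: x g_def)
  have cons: "A_class (x # w) = A_class [x] \<otimes>\<^bsub>A_group G\<^esub> A_class w"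
    using Cons.prems by (intro A_class_Cons) auto
  have xcl: "A_class [x] \<in> carrier (A_group G)" using Cons.prems by (simp add: A_class_closed)
  have "A_gen G a \<otimes>\<^bsub>A_group G\<^esub> A_class (x # w) =
      A_class [x] \<otimes>\<^bsub>A_group G\<^esub> (A_gen G a' \<otimes>\<^bsub>A_group G\<^esub> A_class w)"
    using step w a' Cons.prems xcl by (simp add: cons cl A.m_assoc[symmetric])
  also have "\<dots> = A_class (x # w) \<otimes>\<^bsub>A_group G\<^esub> A_gen G (inv (word_val G w) \<otimes> a' \<otimes> word_val G w)"
    using Cons.IH[OF w a'] w a' xcl by (simp add: cons cl A.m_assoc)
  also have "inv (word_val G w) \<otimes> a' \<otimes> word_val G w =
      inv (word_val G (x # w)) \<otimes> a \<otimes> word_val G (x # w)"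
    unfolding v a'_def using g Cons.prems by (simp add: cl inv_mult_group m_assoc)
  finally show ?case .
qed

text \<open>By \<open>A_gen_mult_class\<close>, moving a generator past \<open>z\<close> conjugates
  its index by the image of \<open>z\<close>, which is trivial. So \<open>z\<close> commutes with
  all generators, hence with their inverses and with all words.\<close>

lemma A_proj_kernel_central:
  assumes z: "z \<in> carrier (A_group G)" "A_proj G z = \<one>" and x: "x \<in> carrier (A_group G)"
  shows "x \<otimes>\<^bsub>A_group G\<^esub> z = z \<otimes>\<^bsub>A_group G\<^esub> x"
proof -
  obtain w where w: "w \<in> gwords (carrier G)" "z = A_class w"
    using z by (auto simp: carrier_A_group)
  have val: "word_val G w = \<one>" using z w by (simp add: A_proj_class)
  have gen: "A_gen G a \<otimes>\<^bsub>A_group G\<^esub> z = z \<otimes>\<^bsub>A_group G\<^esub> A_gen G a" if "a \<in> carrier G" for a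
    using A_gen_mult_class[OF w(1) that] that by (simp add: w(2) val)
  have letter: "A_class [(a, s)] \<otimes>\<^bsub>A_group G\<^esub> z = z \<otimes>\<^bsub>A_group G\<^esub> A_class [(a, s)]"
    if "a \<in> carrier G" for a s
  proof (cases s)
    case True
    then show ?thesis using gen that by (simp add: A_class_letter)
  next
    case False
    have "z \<otimes>\<^bsub>A_group G\<^esub> inv\<^bsub>A_group G\<^esub> A_gen G a =
        inv\<^bsub>A_group G\<^esub> A_gen G a \<otimes>\<^bsub>A_group G\<^esub> (A_gen G a \<otimes>\<^bsub>A_group G\<^esub> z) \<otimes>\<^bsub>A_group G\<^esub> inv\<^bsub>A_group G\<^esub> A_gen G a"
      using that z by (simp add: A_gen_closed A.m_assoc[symmetric])
    also have "\<dots> = inv\<^bsub>A_group G\<^esub> A_gen G a \<otimes>\<^bsub>A_group G\<^esub> z"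
      unfolding gen[OF that] using that z by (simp add: A_gen_closed A.m_assoc)
    finally show ?thesis using False that by (simp add: A_class_letter)
  qed
  obtain v where v: "v \<in> gwords (carrier G)" "x = A_class v"
    using x by (auto simp: carrier_A_group)
  have "A_class v \<otimes>\<^bsub>A_group G\<^esub> z = z \<otimes>\<^bsub>A_group G\<^esub> A_class v"
    using v(1)
  proof (induction v)
    case Nil
    then show ?case using z by (simp add: one_A_group[symmetric])
  next
    case (Cons y v)
    obtain a s where y: "y = (a, s)" by (cases y)
    have a: "a \<in> carrier G" and v: "v \<in> gwords (carrier G)" using Cons.prems y by auto
    have c: "A_class [(a, s)] \<in> carrier (A_group G)" "A_class v \<in> carrier (A_group G)"
      using a v by (auto intro: A_class_closed)
    have "A_class [(a, s)] \<otimes>\<^bsub>A_group G\<^esub> A_class v \<otimes>\<^bsub>A_group G\<^esub> z =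
        A_class [(a, s)] \<otimes>\<^bsub>A_group G\<^esub> z \<otimes>\<^bsub>A_group G\<^esub> A_class v"
      using Cons.IH[OF v] c z by (simp add: A.m_assoc)
    also have "\<dots> = z \<otimes>\<^bsub>A_group G\<^esub> (A_class [(a, s)] \<otimes>\<^bsub>A_group G\<^esub> A_class v)"
      unfolding letter[OF a] using c z by (simp add: A.m_assoc)
    finally show ?case using a v by (simp add: y A_class_Cons[of _ v])
  qed
  then show ?thesis by (simp add: v(2))
qed

section \<open>Degree homomorphisms from \<open>A_group G\<close> to the integers\<close>

lemma class_degree_cong:
  assumes D: "\<And>a b. a \<in> carrier G \<Longrightarrow> b \<in> carrier G \<Longrightarrow> inv b \<otimes> a \<otimes> b \<in> D \<longleftrightarrow> a \<in> D"
    and "(u, v) \<in> pres_rel (carrier G) (A_rels G)"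
  shows "class_degree D u = class_degree D v"
  using assms(2)
proof (induction rule: pres_rel.induct)
  case (cancel u v a s)
  then show ?case by (simp add: class_degree_def)
next
  case (relator u v l r)
  \<comment> \<open>A defining relation keeps the letter \<open>b\<close> and replaces
    \<open>a\<close> by a conjugate, which lies in \<open>D\<close> exactly when \<open>a\<close>
    does.\<close>
  then have "class_degree D l = class_degree D r"
    by (auto simp: A_rels_def class_degree_def D)
  then show ?case by simp
qed auto

context
  fixes D
  assumes conj_invariant:
    "\<And>a b. a \<in> carrier G \<Longrightarrow> b \<in> carrier G \<Longrightarrow> inv b \<otimes> a \<otimes> b \<in> D \<longleftrightarrow> a \<in> D"
begin

lemma A_degree_class:
  assumes "w \<in> gwords (carrier G)"
  shows "A_degree D (A_class w) = class_degree D w"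
proof -
  have "w \<in> A_class w" using assms by (simp add: pres_rel.refl)
  then have "(SOME v. v \<in> A_class w) \<in> A_class w" by (rule someI)
  then have "class_degree D w = class_degree D (SOME v. v \<in> A_class w)"
    by (intro class_degree_cong conj_invariant) simp_all
  then show ?thesis by (simp add: A_degree_def)
qed

lemma A_degree_one: "A_degree D \<one>\<^bsub>A_group G\<^esub> = 0"
  by (simp add: one_A_group A_degree_class)

lemma A_degree_mult:
  "x \<in> carrier (A_group G) \<Longrightarrow> y \<in> carrier (A_group G) \<Longrightarrow>
    A_degree D (x \<otimes>\<^bsub>A_group G\<^esub> y) = A_degree D x + A_degree D y"
  by (auto simp: carrier_A_group A_class_append[symmetric] A_degree_class)

lemma A_degree_inv:
  "x \<in> carrier (A_group G) \<Longrightarrow> A_degree D (inv\<^bsub>A_group G\<^esub> x) = - A_degree D x"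
  using A_degree_mult[of x "inv\<^bsub>A_group G\<^esub> x"] A_degree_one by simp

lemma A_degree_nat_pow:
  "x \<in> carrier (A_group G) \<Longrightarrow> A_degree D (x [^]\<^bsub>A_group G\<^esub> (n::nat)) = int n * A_degree D x"
  by (induction n) (simp_all add: A_degree_one A_degree_mult distrib_right)

lemma A_degree_int_pow:
  "x \<in> carrier (A_group G) \<Longrightarrow> A_degree D (x [^]\<^bsub>A_group G\<^esub> (n::int)) = n * A_degree D x"
  by (cases n rule: int_cases2)
    (auto simp: int_pow_int A.int_pow_neg_int A_degree_nat_pow A_degree_inv)

lemma A_degree_zero_subgroup:
  "subgroup {x \<in> carrier (A_group G). A_degree D x = 0} (A_group G)"
  by (rule A.subgroupI) (auto simp: A_degree_mult A_degree_inv intro: A_degree_one)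

text \<open>The integers are abelian, so every commutator has degree zero, and the elements of
  degree zero form a subgroup.\<close>

lemma A_degree_derived:
  assumes "x \<in> derived (A_group G) (carrier (A_group G))"
  shows "A_degree D x = 0"
proof -
  have "derived (A_group G) (carrier (A_group G)) \<subseteq> {x \<in> carrier (A_group G). A_degree D x = 0}"
    unfolding derived_def
    by (rule A.generate_subgroup_incl[OF _ A_degree_zero_subgroup])
      (auto simp: A_degree_mult A_degree_inv)
  then show ?thesis using assms by auto
qed

end

section \<open>Conjugacy classes and products of central powers\<close>

lemma conj_class_invariant:
  assumes "x \<in> carrier G" "a \<in> carrier G" "b \<in> carrier G"
  shows "inv b \<otimes> a \<otimes> b \<in> conj_class G x \<longleftrightarrow> a \<in> conj_class G x"
proof
  assume "inv b \<otimes> a \<otimes> b \<in> conj_class G x"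
  then obtain g where g: "g \<in> carrier G" "inv b \<otimes> a \<otimes> b = inv g \<otimes> x \<otimes> g"
    by (auto simp: conj_class_def)
  have "b \<otimes> (inv b \<otimes> a \<otimes> b) \<otimes> inv b = (b \<otimes> inv b) \<otimes> a \<otimes> (b \<otimes> inv b)"
    using assms by (simp only: m_assoc m_closed inv_closed)
  then have "a = b \<otimes> (inv b \<otimes> a \<otimes> b) \<otimes> inv b" using assms by simp
  also have "\<dots> = inv (g \<otimes> inv b) \<otimes> x \<otimes> (g \<otimes> inv b)"
    unfolding g(2) using g(1) assms by (simp add: inv_mult_group m_assoc)
  finally show "a \<in> conj_class G x" using g(1) assms by (auto simp: conj_class_def)
next
  assume "a \<in> conj_class G x"
  then obtain g where g: "g \<in> carrier G" "a = inv g \<otimes> x \<otimes> g"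
    by (auto simp: conj_class_def)
  have "inv b \<otimes> a \<otimes> b = inv (g \<otimes> b) \<otimes> x \<otimes> (g \<otimes> b)"
    unfolding g(2) using g(1) assms by (simp add: inv_mult_group m_assoc)
  then show "inv b \<otimes> a \<otimes> b \<in> conj_class G x" using g(1) assms
    unfolding conj_class_def by blast
qed

lemma conj_class_self: "x \<in> carrier G \<Longrightarrow> x \<in> conj_class G x"
  by (auto simp: conj_class_def intro!: exI[of _ \<one>])

text \<open>Every power of \<open>g\<close> lies in the kernel and is therefore central, so all
  occurrences of \<open>g\<close> can be collected in front. This isolates the exponent of a single
  power in the induction of \<open>generate_A_powers_degree_zero\<close>.\<close>

lemma generate_insert_A_proj_kernel:
  assumes g: "g \<in> carrier (A_group G)" "A_proj G g = \<one>" and S: "S \<subseteq> carrier (A_group G)"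
    and "z \<in> generate (A_group G) (insert g S)"
  shows "\<exists>n::int. \<exists>y \<in> generate (A_group G) S. z = g [^]\<^bsub>A_group G\<^esub> n \<otimes>\<^bsub>A_group G\<^esub> y"
  using assms(4)
proof (induction rule: generate.induct)
  case one
  show ?case by (intro exI[of _ 0] bexI[of _ "\<one>\<^bsub>A_group G\<^esub>"]) (auto intro: generate.one)
next
  case (incl h)
  show ?case
  proof (cases "h = g")
    case True
    then show ?thesis using g
      by (intro exI[of _ 1] bexI[of _ "\<one>\<^bsub>A_group G\<^esub>"]) (auto intro: generate.one)
  next
    case False
    then show ?thesis using incl S by (intro exI[of _ 0] bexI[of _ h]) (auto intro: generate.incl)
  qed
next
  case (inv h)
  show ?case
  proof (cases "h = g")
    case True
    then show ?thesis using g
      by (intro exI[of _ "-1"] bexI[of _ "\<one>\<^bsub>A_group G\<^esub>"])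
        (auto simp: A.int_pow_neg intro: generate.one)
  next
    case False
    then show ?thesis using inv S
      by (intro exI[of _ 0] bexI[of _ "inv\<^bsub>A_group G\<^esub> h"]) (auto intro: generate.inv)
  qed
next
  case (eng h1 h2)
  then obtain n m :: int and y1 y2
    where y: "y1 \<in> generate (A_group G) S" "y2 \<in> generate (A_group G) S"
      and h: "h1 = g [^]\<^bsub>A_group G\<^esub> n \<otimes>\<^bsub>A_group G\<^esub> y1" "h2 = g [^]\<^bsub>A_group G\<^esub> m \<otimes>\<^bsub>A_group G\<^esub> y2"
    by blast
  have yc: "y1 \<in> carrier (A_group G)" "y2 \<in> carrier (A_group G)"
    using y A.generate_in_carrier[OF S] by auto
  have c: "y1 \<otimes>\<^bsub>A_group G\<^esub> g [^]\<^bsub>A_group G\<^esub> m = g [^]\<^bsub>A_group G\<^esub> m \<otimes>\<^bsub>A_group G\<^esub> y1"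
    using g yc pi.hom_int_pow[of g m] by (intro A_proj_kernel_central) auto
  have "h1 \<otimes>\<^bsub>A_group G\<^esub> h2 = g [^]\<^bsub>A_group G\<^esub> n \<otimes>\<^bsub>A_group G\<^esub> (y1 \<otimes>\<^bsub>A_group G\<^esub> g [^]\<^bsub>A_group G\<^esub> m) \<otimes>\<^bsub>A_group G\<^esub> y2"
    using g yc by (simp add: h A.m_assoc)
  also have "\<dots> = g [^]\<^bsub>A_group G\<^esub> (n + m) \<otimes>\<^bsub>A_group G\<^esub> (y1 \<otimes>\<^bsub>A_group G\<^esub> y2)"
    unfolding c using g yc by (simp add: A.int_pow_mult A.m_assoc)
  finally show ?case using generate.eng[OF y] by blast
qed

text \<open>For a pair \<open>(a, k)\<close> this is the k-th power of the generator indexed by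
  \<open>a\<close>. It is taken as the class of the left side of the power relation, so that
  applying that relation to a word produces exactly this factor.\<close>

abbreviation A_power :: "'a \<times> nat \<Rightarrow> 'a gword set" where
  "A_power p \<equiv> A_class (replicate (snd p) (fst p, True))"

lemma A_power_closed: "fst p \<in> carrier G \<Longrightarrow> A_power p \<in> carrier (A_group G)"
  by (simp add: A_class_closed gwords_replicate)

text \<open>The degrees separate powers attached to different conjugacy classes: a power with
  positive exponent has nonzero degree on its own class and degree zero on every other.\<close>

lemma A_degree_A_power:
  assumes "x \<in> carrier G" "fst p \<in> carrier G"
  shows "A_degree (conj_class G x) (A_power p) = (if fst p \<in> conj_class G x then int (snd p) else 0)"
proof -
  have "A_degree (conj_class G x) (A_power p) =
      class_degree (conj_class G x) (replicate (snd p) (fst p, True))"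
    by (rule A_degree_class)
      (use assms in \<open>simp_all add: conj_class_invariant gwords_replicate\<close>)
  then show ?thesis by (simp add: class_degree_def sum_list_replicate)
qed

text \<open>The powers are central and belong to distinct conjugacy classes, so the class degrees
  exhibit them as a basis of a free abelian group.\<close>

lemma generate_A_powers_degree_zero:
  assumes "finite F"
    and "\<And>p. p \<in> F \<Longrightarrow> fst p \<in> carrier G \<and> snd p > 0 \<and> A_proj G (A_power p) = \<one>"
    and "\<And>p q. p \<in> F \<Longrightarrow> q \<in> F \<Longrightarrow> fst q \<in> conj_class G (fst p) \<Longrightarrow> p = q"
    and "z \<in> generate (A_group G) (A_power ` F)"
    and "\<And>p. p \<in> F \<Longrightarrow> A_degree (conj_class G (fst p)) z = 0"
  shows "z = \<one>\<^bsub>A_group G\<^esub>"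
  using assms
proof (induction F arbitrary: z rule: finite_induct)
  case empty
  then show ?case using A.generate_empty by simp
next
  case (insert p F)
  let ?D = "conj_class G (fst p)"
  have p: "fst p \<in> carrier G" "snd p > 0" "A_proj G (A_power p) = \<one>" using insert.prems by auto
  have F: "A_power ` F \<subseteq> carrier (A_group G)"
    using insert.prems(1) by (auto intro!: A_power_closed)
  have pc: "A_power p \<in> carrier (A_group G)" using p by (intro A_power_closed)
  have "z \<in> generate (A_group G) (insert (A_power p) (A_power ` F))"
    using insert.prems(3) by simp
  then obtain n :: int and y where y: "y \<in> generate (A_group G) (A_power ` F)"
    and z: "z = A_power p [^]\<^bsub>A_group G\<^esub> n \<otimes>\<^bsub>A_group G\<^esub> y"
    using generate_insert_A_proj_kernel[OF pc p(3) F] by blast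
  have yc: "y \<in> carrier (A_group G)" using y A.generate_in_carrier[OF F] by auto
  have "A_power ` F \<subseteq> {x \<in> carrier (A_group G). A_degree ?D x = 0}"
  proof (clarify, intro conjI)
    fix a k assume q: "(a, k) \<in> F"
    show "A_power (a, k) \<in> carrier (A_group G)" using F q by blast
    \<comment> \<open>If \<open>a\<close> were in the class of \<open>fst p\<close>, the uniqueness
      hypothesis would give \<open>p = (a, k)\<close>, but \<open>p\<close> is not in
      \<open>F\<close>.\<close>
    have "a \<notin> ?D" using insert.hyps(2) insert.prems(2)[of p "(a, k)"] q by auto
    then show "A_degree ?D (A_power (a, k)) = 0"
      using A_degree_A_power[OF p(1), of "(a, k)"] insert.prems(1)[of "(a, k)"] q by simp
  qed
  then have "A_degree ?D y = 0"
    using A.generate_subgroup_incl[OF _ A_degree_zero_subgroup[OF conj_class_invariant[OF p(1)]]] y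
    by blast
  moreover have "A_degree ?D z = n * int (snd p) + A_degree ?D y"
    using pc yc p conj_class_self[OF p(1)] A_degree_A_power[OF p(1) p(1)]
    by (simp add: z A_degree_mult[OF conj_class_invariant[OF p(1)]]
        A_degree_int_pow[OF conj_class_invariant[OF p(1)]])
  \<comment> \<open>The degree of \<open>z\<close> on the class of \<open>fst p\<close> vanishes by
    hypothesis, so \<open>n * snd p\<close> is zero while \<open>snd p\<close> is positive.\<close>
  ultimately have "n = 0" using insert.prems(4)[of p] p(2) by simp
  then have zy: "z = y" using yc by (simp add: z)
  show ?case
  proof (rule insert.IH)
    show "z \<in> generate (A_group G) (A_power ` F)" using y zy by simp
  qed (use insert.prems in auto)
qed

section \<open>Words in \<Gamma> and the relations of \<open>G\<close> lifted to
  \<open>A_group G\<close>\<close>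

lemma A_proj_A_power:
  assumes pres: "is_presentation G \<Gamma> (conj_rels C \<union> power_rels P)" and p: "p \<in> P" "fst p \<in> \<Gamma>"
  shows "A_proj G (A_power p) = \<one>"
proof -
  let ?w = "replicate (snd p) (fst p, True)" and ?R = "conj_rels C \<union> power_rels P"
  have w: "?w \<in> gwords \<Gamma>" using p by (simp add: gwords_replicate)
  have "(?w, []) \<in> ?R" using p by (cases p) (auto simp: power_rels_def)
  then have "(?w, []) \<in> pres_rel \<Gamma> ?R"
    using pres_rel.relator[of "[]" \<Gamma> "[]" ?w "[]" ?R] w by simp
  then have "word_val G ?w = \<one>"
    using is_presentation_pres_rel_iff[OF is_group pres w, of "[]"] by simp
  moreover have "\<Gamma> \<subseteq> carrier G" using pres by (simp add: is_presentation_def)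
  ultimately show ?thesis using A_proj_class w gwords_mono by fastforce
qed

text \<open>A derivation in the presentation of \<open>G\<close> is replayed in
  \<open>A_group G\<close>. Cancellations and conjugation relations hold there already, and a power
  relation costs a factor \<open>A_power p\<close>. These factors are central, so they can be
  gathered in one element \<open>z\<close> at the right end.\<close>

lemma pres_rel_A_class:
  assumes pres: "is_presentation G \<Gamma> (conj_rels C \<union> power_rels P)"
    and C: "C \<subseteq> \<Gamma> \<times> \<Gamma> \<times> \<Gamma>" and P: "fst ` P \<subseteq> \<Gamma>"
    and "(u, v) \<in> pres_rel \<Gamma> (conj_rels C \<union> power_rels P)"
  shows "\<exists>z \<in> generate (A_group G) (A_power ` P). A_class u = A_class v \<otimes>\<^bsub>A_group G\<^esub> z"
proof -
  let ?R = "conj_rels C \<union> power_rels P" and ?Z = "generate (A_group G) (A_power ` P)"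
  have \<Gamma>: "\<Gamma> \<subseteq> carrier G" using pres by (simp add: is_presentation_def)
  note gw = subsetD[OF gwords_mono[OF \<Gamma>]]
  have Pc: "A_power ` P \<subseteq> carrier (A_group G)"
    using P \<Gamma> by (auto intro!: A_power_closed)
  have Zc: "z \<in> carrier (A_group G)" if "z \<in> ?Z" for z
    using that A.generate_in_carrier[OF Pc] by blast
  \<comment> \<open>The powers lie in the kernel by \<open>A_proj_A_power\<close>, hence so does the
    subgroup they generate; with \<open>A_proj_kernel_central\<close> its elements are
    central.\<close>
  have Zker: "A_proj G z = \<one>" if "z \<in> ?Z" for z
  proof -
    have "A_power ` P \<subseteq> kernel (A_group G) G (A_proj G)"
      using Pc P A_proj_A_power[OF pres] unfolding kernel_def by blast
    then have "?Z \<subseteq> kernel (A_group G) G (A_proj G)"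
      by (intro A.generate_subgroup_incl pi.subgroup_kernel)
    then show ?thesis using that by (auto simp: kernel_def)
  qed
  show ?thesis using assms(4)
  proof (induction rule: pres_rel.induct)
    case (refl w)
    then show ?case using gw[of w]
      by (intro bexI[of _ "\<one>\<^bsub>A_group G\<^esub>"]) (auto simp: A_class_closed intro: generate.one)
  next
    case (sym u v)
    then obtain z where z: "z \<in> ?Z" "A_class u = A_class v \<otimes>\<^bsub>A_group G\<^esub> z" by blast
    have "v \<in> gwords \<Gamma>" using sym pres_rel_gwords by blast
    then have "A_class v = A_class u \<otimes>\<^bsub>A_group G\<^esub> inv\<^bsub>A_group G\<^esub> z"
      using z Zc gw by (simp add: A_class_closed A.m_assoc)
    then show ?case using A.generate_m_inv_closed[OF Pc z(1)] by blast
  next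
    case (trans u v w)
    then obtain y z where z: "y \<in> ?Z" "A_class u = A_class v \<otimes>\<^bsub>A_group G\<^esub> y"
      "z \<in> ?Z" "A_class v = A_class w \<otimes>\<^bsub>A_group G\<^esub> z" by blast
    have "w \<in> gwords \<Gamma>" using trans pres_rel_gwords by blast
    then have "A_class u = A_class w \<otimes>\<^bsub>A_group G\<^esub> (z \<otimes>\<^bsub>A_group G\<^esub> y)"
      using z Zc gw by (simp add: A_class_closed A.m_assoc)
    then show ?case using generate.eng[OF z(3,1)] by blast
  next
    case (cancel u v a s)
    then have g: "u \<in> gwords (carrier G)" "v \<in> gwords (carrier G)" "a \<in> carrier G"
      using gw \<Gamma> by auto
    then have "A_class (u @ [(a, s), (a, \<not> s)] @ v) = A_class (u @ v)"
      using pres_rel.cancel[OF g] by (subst pres_class_eq_iff) auto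
    then show ?case using g
      by (intro bexI[of _ "\<one>\<^bsub>A_group G\<^esub>"]) (auto simp: A_class_closed intro: generate.one)
  next
    case (relator u v l r)
    have g: "u \<in> gwords (carrier G)" "v \<in> gwords (carrier G)"
        "l \<in> gwords (carrier G)" "r \<in> gwords (carrier G)"
      using relator gw by auto
    have "\<exists>z\<in>?Z. A_class l = A_class r \<otimes>\<^bsub>A_group G\<^esub> z"
      using relator(5)
    proof
      assume "(l, r) \<in> conj_rels C"
      then obtain a b c where lr: "l = [(b, False), (a, True), (b, True)]" "r = [(c, True)]"
        and abc: "(a, b, c) \<in> C" by (auto simp: conj_rels_def)
      have car: "a \<in> carrier G" "b \<in> carrier G" "c \<in> carrier G" using abc C \<Gamma> by auto
      \<comment> \<open>The relation holds in \<open>G\<close>, which forces \<open>c\<close> to be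
        the conjugate of \<open>a\<close> by \<open>b\<close>; that is the index occurring in the
        defining relation of \<open>A_group G\<close> for \<open>a\<close> and
        \<open>b\<close>.\<close>
      have "(l, r) \<in> pres_rel \<Gamma> ?R"
        using pres_rel.relator[of "[]" \<Gamma> "[]" l r ?R] relator by simp
      then have "word_val G l = word_val G r"
        using is_presentation_pres_rel_iff[OF is_group pres] relator by blast
      then have c: "c = inv b \<otimes> a \<otimes> b" using car by (simp add: lr m_assoc)
      have "A_class l = inv\<^bsub>A_group G\<^esub> A_gen G b \<otimes>\<^bsub>A_group G\<^esub> (A_gen G a \<otimes>\<^bsub>A_group G\<^esub> A_gen G b)"
        using car by (simp add: lr A_class_Cons[of _ "_ # _"] A_class_letter)
      also have "\<dots> = A_gen G c"
        using car A_gen_mult[of a b] unfolding c[symmetric]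
        by (simp add: A_gen_closed A.m_assoc[symmetric])
      also have "\<dots> = A_class r" using car by (simp add: lr A_class_letter)
      finally show ?thesis using g
        by (intro bexI[of _ "\<one>\<^bsub>A_group G\<^esub>"]) (auto simp: A_class_closed intro: generate.one)
    next
      assume "(l, r) \<in> power_rels P"
      then obtain p where "p \<in> P" "l = replicate (snd p) (fst p, True)" "r = []"
        by (force simp: power_rels_def)
      then show ?thesis using g
        by (intro bexI[of _ "A_class l"])
          (auto simp: one_A_group[symmetric] A_class_closed intro: generate.incl)
    qed
    then obtain z where z: "z \<in> ?Z" "A_class l = A_class r \<otimes>\<^bsub>A_group G\<^esub> z" by blast
    \<comment> \<open>Centrality carries the error factor past the right context
      \<open>v\<close>.\<close>
    have "A_class v \<otimes>\<^bsub>A_group G\<^esub> z = z \<otimes>\<^bsub>A_group G\<^esub> A_class v"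
      using z Zc Zker g by (intro A_proj_kernel_central) (auto intro: A_class_closed)
    then have "A_class (u @ l @ v) = A_class (u @ r @ v) \<otimes>\<^bsub>A_group G\<^esub> z"
      using z Zc g by (simp add: A_class_append A_class_closed A.m_assoc)
    then show ?case using z(1) by blast
  qed
qed

text \<open>The subgroup generated by the generators with index in \<open>X\<close> is described by
  words rather than by \<open>generate\<close>, so that each of its elements comes with a word to
  which the presentation of \<open>G\<close> applies.\<close>

lemma A_class_image_subgroup:
  assumes "X \<subseteq> carrier G"
  shows "subgroup (A_class ` gwords X) (A_group G)"
proof (rule A.subgroupI)
  note gw = subsetD[OF gwords_mono[OF assms]]
  show "A_class ` gwords X \<subseteq> carrier (A_group G)" using gw by (auto intro: A_class_closed)
  show "A_class ` gwords X \<noteq> {}" using gwords_Nil by blast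
  show "x \<otimes>\<^bsub>A_group G\<^esub> y \<in> A_class ` gwords X"
    if "x \<in> A_class ` gwords X" "y \<in> A_class ` gwords X" for x y
    using that gw by (auto simp: A_class_append[symmetric])
  show "inv\<^bsub>A_group G\<^esub> x \<in> A_class ` gwords X" if "x \<in> A_class ` gwords X" for x
  proof -
    obtain w where w: "w \<in> gwords X" "x = A_class w" using \<open>x \<in> _\<close> by blast
    let ?i = "map (\<lambda>(a, s). (a, \<not> s)) (rev w)"
    have i: "?i \<in> gwords X" using w(1) by (auto simp: gwords_def)
    have "A_class (?i @ w) = A_class []"
      using gw[OF w(1)] gw[OF i] pres_rel_inverse by (subst pres_class_eq_iff) auto
    then have "A_class ?i \<otimes>\<^bsub>A_group G\<^esub> x = \<one>\<^bsub>A_group G\<^esub>"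
      using gw[OF w(1)] gw[OF i] A_class_append w(2) one_A_group by metis
    then have "inv\<^bsub>A_group G\<^esub> x = A_class ?i"
      using gw[OF w(1)] gw[OF i] w(2) by (intro A.inv_equality) (auto intro: A_class_closed)
    then show ?thesis using i by blast
  qed
qed

text \<open>Every element of the group is a word in \<open>\<Gamma>\<close> times a central element, and the
  central factors drop out of commutators.\<close>

lemma A_derived_subset_generators:
  assumes pres: "is_presentation G \<Gamma> R"
  shows "derived (A_group G) (carrier (A_group G)) \<subseteq> A_class ` gwords \<Gamma>"
proof -
  let ?H = "A_class ` gwords \<Gamma>"
  have \<Gamma>: "\<Gamma> \<subseteq> carrier G" using pres by (simp add: is_presentation_def)
  note gw = subsetD[OF gwords_mono[OF \<Gamma>]]
  have sub: "subgroup ?H (A_group G)" using \<Gamma> by (rule A_class_image_subgroup)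
  have split: "\<exists>h \<in> ?H. \<exists>k. k \<in> carrier (A_group G) \<and> A_proj G k = \<one> \<and> x = h \<otimes>\<^bsub>A_group G\<^esub> k"
    if x: "x \<in> carrier (A_group G)" for x
  proof -
    \<comment> \<open>A word in \<Gamma> with the same value as the image of \<open>x\<close> gives
      an element \<open>?h\<close> that differs from \<open>x\<close> by an element of the
      kernel.\<close>
    obtain w where w: "w \<in> gwords \<Gamma>" "word_val G w = A_proj G x"
      using is_presentation_word_val_surj[OF is_group pres] pi.hom_closed[OF x] by metis
    let ?h = "A_class w"
    have h: "?h \<in> carrier (A_group G)" "A_proj G ?h = A_proj G x"
      using w gw by (auto simp: A_class_closed A_proj_class)
    have "A_proj G (inv\<^bsub>A_group G\<^esub> ?h \<otimes>\<^bsub>A_group G\<^esub> x) = \<one>" using h x by simp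
    moreover have "x = ?h \<otimes>\<^bsub>A_group G\<^esub> (inv\<^bsub>A_group G\<^esub> ?h \<otimes>\<^bsub>A_group G\<^esub> x)"
      using h x by (simp add: A.m_assoc[symmetric])
    ultimately show ?thesis using w h x by blast
  qed
  have "x \<otimes>\<^bsub>A_group G\<^esub> y \<otimes>\<^bsub>A_group G\<^esub> inv\<^bsub>A_group G\<^esub> x \<otimes>\<^bsub>A_group G\<^esub> inv\<^bsub>A_group G\<^esub> y \<in> ?H"
    if xy: "x \<in> carrier (A_group G)" "y \<in> carrier (A_group G)" for x y
  proof -
    obtain h k where h: "h \<in> ?H" "x = h \<otimes>\<^bsub>A_group G\<^esub> k"
      and k: "k \<in> carrier (A_group G)" "A_proj G k = \<one>" using split[OF xy(1)] by blast
    obtain h' k' where h': "h' \<in> ?H" "y = h' \<otimes>\<^bsub>A_group G\<^esub> k'"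
      and k': "k' \<in> carrier (A_group G)" "A_proj G k' = \<one>" using split[OF xy(2)] by blast
    have hc: "h \<in> carrier (A_group G)" "h' \<in> carrier (A_group G)"
      using h(1) h'(1) subgroup.subset[OF sub] by auto
    \<comment> \<open>The two products \<open>x y\<close> and \<open>y x\<close> carry the same
      central factor \<open>k k'\<close>. It cancels once the commutator is written as
      \<open>x y\<close> times the inverse of \<open>y x\<close>.\<close>
    have 1: "x \<otimes>\<^bsub>A_group G\<^esub> y = h \<otimes>\<^bsub>A_group G\<^esub> h' \<otimes>\<^bsub>A_group G\<^esub> (k \<otimes>\<^bsub>A_group G\<^esub> k')"
    proof -
      have "x \<otimes>\<^bsub>A_group G\<^esub> y = h \<otimes>\<^bsub>A_group G\<^esub> (k \<otimes>\<^bsub>A_group G\<^esub> h') \<otimes>\<^bsub>A_group G\<^esub> k'" using h h' k k' hc by (simp add: A.m_assoc)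
      also have "k \<otimes>\<^bsub>A_group G\<^esub> h' = h' \<otimes>\<^bsub>A_group G\<^esub> k" using A_proj_kernel_central[OF k hc(2)] by simp
      finally show ?thesis using k k' hc by (simp add: A.m_assoc)
    qed
    have 2: "y \<otimes>\<^bsub>A_group G\<^esub> x = h' \<otimes>\<^bsub>A_group G\<^esub> h \<otimes>\<^bsub>A_group G\<^esub> (k \<otimes>\<^bsub>A_group G\<^esub> k')"
    proof -
      have "y \<otimes>\<^bsub>A_group G\<^esub> x = h' \<otimes>\<^bsub>A_group G\<^esub> (k' \<otimes>\<^bsub>A_group G\<^esub> h) \<otimes>\<^bsub>A_group G\<^esub> k" using h h' k k' hc by (simp add: A.m_assoc)
      also have "k' \<otimes>\<^bsub>A_group G\<^esub> h = h \<otimes>\<^bsub>A_group G\<^esub> k'" using A_proj_kernel_central[OF k' hc(1)] by simp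
      finally show ?thesis using A_proj_kernel_central[OF k k'(1)] k k' hc
        by (simp add: A.m_assoc)
    qed
    have "x \<otimes>\<^bsub>A_group G\<^esub> y \<otimes>\<^bsub>A_group G\<^esub> inv\<^bsub>A_group G\<^esub> x \<otimes>\<^bsub>A_group G\<^esub> inv\<^bsub>A_group G\<^esub> y = (x \<otimes>\<^bsub>A_group G\<^esub> y) \<otimes>\<^bsub>A_group G\<^esub> inv\<^bsub>A_group G\<^esub> (y \<otimes>\<^bsub>A_group G\<^esub> x)"
      using xy by (simp add: A.inv_mult_group A.m_assoc)
    also have "\<dots> = h \<otimes>\<^bsub>A_group G\<^esub> h' \<otimes>\<^bsub>A_group G\<^esub> ((k \<otimes>\<^bsub>A_group G\<^esub> k') \<otimes>\<^bsub>A_group G\<^esub> inv\<^bsub>A_group G\<^esub> (k \<otimes>\<^bsub>A_group G\<^esub> k')) \<otimes>\<^bsub>A_group G\<^esub> inv\<^bsub>A_group G\<^esub> (h' \<otimes>\<^bsub>A_group G\<^esub> h)"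
      unfolding 1 2 using hc k k'
      by (subst A.inv_mult_group) (simp_all only: A.m_assoc A.m_closed A.inv_closed)
    also have "\<dots> = h \<otimes>\<^bsub>A_group G\<^esub> h' \<otimes>\<^bsub>A_group G\<^esub> inv\<^bsub>A_group G\<^esub> (h' \<otimes>\<^bsub>A_group G\<^esub> h)" using hc k k' by simp
    finally show ?thesis
      using h(1) h'(1) sub by (simp add: subgroup.m_closed subgroup.m_inv_closed)
  qed
  then show ?thesis
    unfolding derived_def by (intro A.generate_subgroup_incl[OF _ sub]) auto
qed

section \<open>Restriction of the projection to the derived subgroups\<close>

lemma A_proj_kernel_derived_trivial:
  assumes "Cbar_group G" and x: "x \<in> derived (A_group G) (carrier (A_group G))" "A_proj G x = \<one>"
  shows "x = \<one>\<^bsub>A_group G\<^esub>"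
proof -
  obtain \<Gamma> C P where C: "C \<subseteq> \<Gamma> \<times> \<Gamma> \<times> \<Gamma>" and P: "P \<subseteq> \<Gamma> \<times> {2..}"
    and pres: "is_presentation G \<Gamma> (conj_rels C \<union> power_rels P)"
    and uniq: "\<forall>x\<in>carrier G. \<forall>p\<in>P. \<forall>q\<in>P.
          fst p \<in> conj_class G x \<and> fst q \<in> conj_class G x \<longrightarrow> p = q"
    using assms(1) unfolding Cbar_group_def by blast
  let ?R = "conj_rels C \<union> power_rels P"
  have \<Gamma>: "\<Gamma> \<subseteq> carrier G" using pres by (simp add: is_presentation_def)
  have P\<Gamma>: "fst ` P \<subseteq> \<Gamma>" using P by auto
  have Pc: "fst p \<in> carrier G" "snd p > 0" if "p \<in> P" for p
    using that P \<Gamma> by (cases p; auto)+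
  obtain w where w: "w \<in> gwords \<Gamma>" "x = A_class w"
    using A_derived_subset_generators[OF pres] x(1) by auto
  have wc: "w \<in> gwords (carrier G)" using w(1) gwords_mono[OF \<Gamma>] by auto
  \<comment> \<open>The word \<open>w\<close> has value one in \<open>G\<close>, so the relations of
    \<open>G\<close> reduce it to the empty word; \<open>pres_rel_A_class\<close> then expresses
    \<open>x\<close> through the powers.\<close>
  have "(w, []) \<in> pres_rel \<Gamma> ?R"
    using is_presentation_pres_rel_iff[OF is_group pres w(1), of "[]"] x(2) wc
    by (simp add: w(2) A_proj_class)
  then obtain z where z: "z \<in> generate (A_group G) (A_power ` P)" "x = \<one>\<^bsub>A_group G\<^esub> \<otimes>\<^bsub>A_group G\<^esub> z"
    using pres_rel_A_class[OF pres C P\<Gamma>, of w "[]"] by (auto simp: one_A_group w(2))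
  have "A_power ` P \<subseteq> carrier (A_group G)"
    using Pc(1) A_power_closed by blast
  then have "z \<in> carrier (A_group G)" using A.generate_in_carrier z(1) by blast
  then have "x \<in> generate (A_group G) (A_power ` P)" using z by simp
  then obtain F where F: "F \<subseteq> P" "finite F" "x \<in> generate (A_group G) (A_power ` F)"
    using generate_finite_support[of x "A_group G" A_power P] by blast
  show ?thesis
  proof (rule generate_A_powers_degree_zero[OF F(2) _ _ F(3)])
    fix p assume "p \<in> F"
    then have p: "p \<in> P" using F(1) by blast
    show "fst p \<in> carrier G \<and> 0 < snd p \<and> A_proj G (A_power p) = \<one>"
      using Pc[OF p] A_proj_A_power[OF pres p] p P\<Gamma> by blast
    show "A_degree (conj_class G (fst p)) x = 0"
      by (intro A_degree_derived conj_class_invariant Pc(1)[OF p] x(1))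
    \<comment> \<open>Both first components lie in the class of \<open>fst p\<close>, which carries
      at most one power relation.\<close>
    show "p = q" if "q \<in> F" "fst q \<in> conj_class G (fst p)" for q
      using uniq Pc(1)[OF p] conj_class_self[of "fst p"] p that F(1) by blast
  qed
qed

lemma A_proj_image: "A_proj G ` carrier (A_group G) = carrier G"
proof
  show "A_proj G ` carrier (A_group G) \<subseteq> carrier G" by auto
  show "carrier G \<subseteq> A_proj G ` carrier (A_group G)"
    using A_gen_closed A_proj_gen by (metis image_eqI subsetI)
qed

text \<open>A homomorphism maps the derived subgroup onto the derived subgroup of its image, and the
  projection is surjective because every \<open>a\<close> is the image of its own generator.\<close>

lemma A_proj_image_derived:
  "A_proj G ` derived (A_group G) (carrier (A_group G)) = derived G (carrier G)"
  using pi.derived_img[of "carrier (A_group G)"] by (simp add: A_proj_image)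

lemma A_proj_inj_on_derived:
  assumes "Cbar_group G"
  shows "inj_on (A_proj G) (derived (A_group G) (carrier (A_group G)))"
proof (rule inj_onI)
  let ?D = "derived (A_group G) (carrier (A_group G))"
  have sub: "subgroup ?D (A_group G)" by (rule A.derived_is_subgroup) simp
  fix x y assume xy: "x \<in> ?D" "y \<in> ?D" "A_proj G x = A_proj G y"
  have c: "x \<in> carrier (A_group G)" "y \<in> carrier (A_group G)"
    using xy subgroup.subset[OF sub] by auto
  have "x \<otimes>\<^bsub>A_group G\<^esub> inv\<^bsub>A_group G\<^esub> y = \<one>\<^bsub>A_group G\<^esub>"
  proof (rule A_proj_kernel_derived_trivial[OF assms])
    show "x \<otimes>\<^bsub>A_group G\<^esub> inv\<^bsub>A_group G\<^esub> y \<in> ?D"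
      using xy sub by (simp add: subgroup.m_closed subgroup.m_inv_closed)
  qed (use xy c in simp)
  then show "x = y" using c by (metis A.inv_equality A.inv_inv A.inv_closed)
qed

end

theorem corollary2p7:
  fixes G :: "('a, 'm) monoid_scheme"
  assumes "Cbar_group G"
  shows "A_proj G \<in> iso ((A_group G)\<lparr>carrier := derived (A_group G) (carrier (A_group G))\<rparr>)
                        (G\<lparr>carrier := derived G (carrier G)\<rparr>)"
proof -
  interpret group G using assms by (simp add: Cbar_group_def)
  interpret A: group "A_group G" unfolding A_group_def by (rule presented_group_group)
  have "derived (A_group G) (carrier (A_group G)) \<subseteq> carrier (A_group G)"
    by (rule A.derived_in_carrier) simp
  then have "A_proj G \<in> hom ((A_group G)\<lparr>carrier := derived (A_group G) (carrier (A_group G))\<rparr>)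
      (G\<lparr>carrier := derived G (carrier G)\<rparr>)"
    using A_proj_hom A_proj_image_derived by (auto simp: hom_def Pi_def subset_iff)
  then show ?thesis
    using A_proj_inj_on_derived[OF assms] A_proj_image_derived
    by (simp add: iso_def bij_betw_def)
qed

end
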